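(* Let $\lambda>0$, $x\in\mathbb{R}$, $\gamma,\rho\in\mathbb{C}$ and $\psi,\phi\in(0,\pi)$ be such that $$|\rho|\,\bigl(\sin\phi+|\sin(\psi-\phi)|\bigr)<\sin\psi.$$ Then $$ (1-\rho)^{-\gamma}\ {}_2F_1\!\left(\begin{matrix}\gamma,\ \lambda+ix\\ 2\lambda\end{matrix};\frac{(1-e^{-2i\phi})\rho}{\rho-1}\right) =\left(1-\frac{\rho\sin(\psi-\phi)}{e^{i\phi}\sin\psi}\right)^{-\gamma}\sum_{k=0}^\infty\frac{\sin^k\phi}{\sin^k\psi}\left(1-\frac{\rho\sin(\psi-\phi)}{e^{i\phi}\sin\psi}\right)^{-k}\frac{(\gamma)_k\,P_k^{(\lambda)}(x;\psi)}{(2\lambda)_k\,e^{ik\phi}}\,\rho^k. $$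
   Context: The Pochhammer symbol is $(z)_n=\prod_{i=1}^n(z+i-1)$ (so $(z)_0=1$), and ${}_2F_1(a_1,a_2;b_1;z)=\sum_{n\ge0}\frac{(a_1)_n(a_2)_n}{(b_1)_n}\frac{z^n}{n!}$, continued analytically from $|z|<1$ to $\mathbb{C}\setminus[1,\infty)$. The Meixner-Pollaczek polynomials are $$P_n^{(\lambda)}(x;\phi)=\frac{(2\lambda)_n}{n!}e^{in\phi}\ {}_2F_1\!\left(\begin{matrix}-n,\ \lambda+ix\\ 2\lambda\end{matrix};1-e^{-2i\phi}\right).$$ The assumption on $\rho$ implies $|\rho|<1$; complex powers are taken with the principal branch. *)

theory Defs
  imports "HOL-Complex_Analysis.Complex_Analysis"
begin

definition hyp2F1_series :: "complex \<Rightarrow> complex \<Rightarrow> complex \<Rightarrow> complex \<Rightarrow> complex" where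
  "hyp2F1_series a b c z = eval_fps (fps_hypergeo [a, b] [c] 1) z"

lemma hyp2F1_series_altdef:
  "hyp2F1_series a b c z =
     (\<Sum>n. pochhammer a n * pochhammer b n / pochhammer c n * (z ^ n / fact n))"
  by (simp add: hyp2F1_series_def eval_fps_def)

abbreviation slit_plane :: "complex set" where
  "slit_plane \<equiv> - (complex_of_real ` {1..})"

text \<open>
  If \<open>a\<close> or \<open>b\<close> is a non-positive integer, the series is a finite sum and is used for every
  \<open>z\<close>; the Meixner-Pollaczek polynomials need this, since \<open>1 - exp (-2i\<phi>)\<close> ranges over a
  circle that meets \<open>[1,\<infinity>)\<close> in the point \<open>2\<close> (\<open>\<phi> = \<pi>/2\<close>). Otherwise the value outside the
  unit disc is that of the analytic continuation of the series to the plane cut along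
  \<open>[1,\<infinity>)\<close>; by the identity theorem it is unique (\<open>hyp2F1_eqI\<close> below). On the cut itself
  the value is unspecified.
\<close>

definition hyp2F1 :: "complex \<Rightarrow> complex \<Rightarrow> complex \<Rightarrow> complex \<Rightarrow> complex" where
  "hyp2F1 a b c z =
     (if a \<in> \<int>\<^sub>\<le>\<^sub>0 \<or> b \<in> \<int>\<^sub>\<le>\<^sub>0 \<or> norm z < 1 then hyp2F1_series a b c z
      else (THE w. \<exists>f. f holomorphic_on slit_plane \<and>
                       (\<forall>u\<in>ball 0 1. f u = hyp2F1_series a b c u) \<and> w = f z))"

lemma open_slit_plane: "open slit_plane"
proof -
  have "closed (complex_of_real ` {1..})"
    by (rule closed_injective_linear_image)
       (auto simp: inj_on_def intro: bounded_linear.linear bounded_linear_of_real)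
  thus ?thesis by (simp add: open_Compl)
qed

lemma slit_plane_iff: "z \<in> slit_plane \<longleftrightarrow> \<not> (Im z = 0 \<and> Re z \<ge> 1)"
  by (auto simp: image_iff complex_eq_iff)

lemma ball_subset_slit_plane: "ball 0 1 \<subseteq> slit_plane"
  by (auto simp: image_iff)

lemma connected_slit_plane: "connected slit_plane"
proof (rule starlike_imp_connected)
  show "starlike slit_plane"
    unfolding starlike_def
  proof (intro bexI ballI subsetI)
    show "(0::complex) \<in> slit_plane" unfolding slit_plane_iff by simp
  next
    fix x y assume x: "x \<in> slit_plane" and "y \<in> closed_segment 0 x"
    then obtain u where u: "0 \<le> u" "u \<le> 1" "y = of_real u * x"
      by (auto simp: in_segment scaleR_conv_of_real)
    show "y \<in> slit_plane"
    proof (rule ccontr)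
      assume "y \<notin> slit_plane"
      hence *: "u * Im x = 0" "u * Re x \<ge> 1" unfolding slit_plane_iff u(3) by auto
      hence "u > 0" using u(1) by (cases "u = 0") auto
      hence "Im x = 0" using *(1) by simp
      moreover have "Re x > 0"
        using * \<open>u > 0\<close> by (metis less_le_trans zero_less_mult_pos zero_less_one)
      moreover from \<open>Re x > 0\<close> have "u * Re x \<le> 1 * Re x" using \<open>Re x > 0\<close> u by (intro mult_right_mono) auto
      ultimately show False using * x unfolding slit_plane_iff by auto
    qed
  qed
qed

lemma hyp2F1_eqI:
  assumes f: "f holomorphic_on slit_plane"
    and eq: "\<And>u. norm u < 1 \<Longrightarrow> f u = hyp2F1_series a b c u"
    and z: "z \<in> slit_plane"
  shows "hyp2F1 a b c z = f z"
proof -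
  have unique: "g z = f z"
    if g: "g holomorphic_on slit_plane" "\<forall>u\<in>ball 0 1. g u = hyp2F1_series a b c u" for g
  proof (rule analytic_continuation_open[OF _ open_slit_plane _ connected_slit_plane
                ball_subset_slit_plane g(1) f _ z])
    show "open (ball (0::complex) 1)" "ball (0::complex) 1 \<noteq> {}" by simp_all
    show "g u = f u" if "u \<in> ball 0 1" for u
      using g(2) eq that by simp
  qed
  consider "norm z < 1" | "norm z \<ge> 1" "a \<in> \<int>\<^sub>\<le>\<^sub>0 \<or> b \<in> \<int>\<^sub>\<le>\<^sub>0" |
    "norm z \<ge> 1" "\<not> (a \<in> \<int>\<^sub>\<le>\<^sub>0 \<or> b \<in> \<int>\<^sub>\<le>\<^sub>0)" by linarith
  then show ?thesis
  proof cases
    case 1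
    thus ?thesis by (simp add: hyp2F1_def eq)
  next
    case 2
    then obtain N where N: "a = - of_nat N \<or> b = - of_nat N"
      by (metis nonpos_Ints_cases')
    let ?t = "\<lambda>n z. pochhammer a n * pochhammer b n / pochhammer c n * (z ^ n / fact n)"
    have ser: "hyp2F1_series a b c = (\<lambda>z. \<Sum>n\<le>N. ?t n z)"
    proof
      fix z
      have "?t n z = 0" if "n \<notin> {..N}" for n
        using N that by (auto simp: pochhammer_of_nat_eq_0_lemma)
      thus "hyp2F1_series a b c z = (\<Sum>n\<le>N. ?t n z)"
        unfolding hyp2F1_series_altdef by (intro suminf_finite) auto
    qed
    have "hyp2F1_series a b c holomorphic_on slit_plane"
      unfolding ser by (intro holomorphic_intros) auto
    from unique[OF this] 2 show ?thesis by (simp add: hyp2F1_def)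
  next
    case 3
    have "(THE w. \<exists>g. g holomorphic_on slit_plane \<and>
             (\<forall>u\<in>ball 0 1. g u = hyp2F1_series a b c u) \<and> w = g z) = f z"
    proof (rule the_equality)
      have "\<forall>u\<in>ball 0 1. f u = hyp2F1_series a b c u" using eq by simp
      with f show "\<exists>g. g holomorphic_on slit_plane \<and>
          (\<forall>u\<in>ball 0 1. g u = hyp2F1_series a b c u) \<and> f z = g z" by blast
    qed (use unique in blast)
    thus ?thesis using 3 by (simp add: hyp2F1_def)
  qed
qed

definition meixner_pollaczek :: "nat \<Rightarrow> real \<Rightarrow> real \<Rightarrow> real \<Rightarrow> complex" where
  "meixner_pollaczek n l x \<phi> =
     pochhammer (of_real (2 * l)) n / fact n * exp (\<i> * of_nat n * of_real \<phi>) *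
     hyp2F1 (- of_nat n) (of_real l + \<i> * of_real x) (of_real (2 * l))
       (1 - exp (- 2 * \<i> * of_real \<phi>))"

end

theory Submission
  imports Defs
begin

text \<open>
  Write \<open>a = l + i x\<close> and \<open>b = l - i x\<close>. Euler's integral
  \<open>\<integral>\<^sub>0\<^sup>1 t\<^sup>a\<^sup>-\<^sup>1 (1 - t)\<^sup>b\<^sup>-\<^sup>1 (1 - z t)\<^sup>-\<^sup>\<gamma> dt\<close>, divided by its value at
  \<open>z = 0\<close>, continues the hypergeometric series to the slit plane, and for \<open>\<gamma> = -k\<close> it gives the
  polynomial case at every \<open>z\<close>. Summing the binomial series under the integral therefore yields,
  for \<open>\<bar>1 - z\<bar> \<le> 1\<close> and \<open>\<bar>w\<bar> < 1\<close>,
  \<open>\<Sum>k. (\<gamma>)\<^sub>k / k! w\<^sup>k F(-k, a; a + b; z) = (1 - w)\<^sup>-\<^sup>\<gamma> F(\<gamma>, a; a + b; z w / (w - 1))\<close>.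
  With \<open>z = 1 - exp (-2i\<psi>)\<close> and \<open>w = \<rho> exp (i(\<psi> - \<phi>)) sin \<phi> / (B sin \<psi>)\<close> one has
  \<open>B (1 - w) = 1 - \<rho>\<close> and \<open>z w / (w - 1) = (1 - exp (-2i\<phi>)) \<rho> / (\<rho> - 1)\<close>;
  the hypothesis on \<open>\<rho>\<close> gives \<open>\<bar>w\<bar> < 1\<close>, and puts \<open>B\<close> and \<open>1 - \<rho>\<close> in the right half plane,
  where the principal powers multiply.
\<close>

subsection \<open>Powers and the binomial series\<close>

text \<open>The arguments of \<open>u\<close> and \<open>u * v\<close> lie strictly between -pi/2
  and pi/2, so their difference stays inside (-pi, pi) and is the principal argument of
  \<open>v\<close>. The factor \<open>v\<close> may itself lie in the left half plane.\<close>

lemma powr_mult_right_halfplane: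
  fixes u v s :: complex
  assumes "Re u > 0" "Re (u * v) > 0"
  shows "(u * v) powr s = u powr s * v powr s"
proof -
  have nz: "u \<noteq> 0" "v \<noteq> 0" using assms by auto
  have "\<bar>Im (Ln u)\<bar> < pi / 2" "\<bar>Im (Ln (u * v))\<bar> < pi / 2"
    by (rule Re_Ln_pos_lt_imp, fact)+
  hence "Ln (exp (Ln (u * v) - Ln u)) = Ln (u * v) - Ln u"
    by (intro Ln_exp) (auto simp only: minus_complex.sel abs_less_iff)
  moreover have "exp (Ln (u * v) - Ln u) = v"
    using nz by (simp add: exp_diff)
  ultimately have "Ln v = Ln (u * v) - Ln u" by simp
  thus ?thesis using nz by (simp add: powr_def flip: exp_add) (simp add: algebra_simps)
qed

lemma pochhammer_binomial_sums:
  fixes g u :: complex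
  assumes "norm u < 1"
  shows "(\<lambda>n. pochhammer g n / fact n * u ^ n) sums (1 - u) powr (- g)"
proof -
  have "(\<lambda>n. ((- g) gchoose n) * (- u) ^ n) sums (1 + (- u)) powr (- g)"
    by (rule gen_binomial_complex) (use assms in simp)
  moreover have "((- g) gchoose n) * (- u) ^ n = pochhammer g n / fact n * u ^ n" for n
  proof -
    have "(- 1) ^ n * (- u) ^ n = u ^ n" by (simp flip: power_mult_distrib)
    thus ?thesis by (simp add: gbinomial_pochhammer)
  qed
  ultimately show ?thesis by simp
qed

text \<open>This is the binomial theorem with the coefficients in the Pochhammer form of the
  terminating hypergeometric series.\<close>

lemma one_minus_power_eq_sum:
  fixes y :: complex
  shows "(1 - y) ^ k = (\<Sum>j\<le>k. pochhammer (- of_nat k) j / fact j * y ^ j)"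
proof -
  have "(1 - y) ^ k = (\<Sum>j\<le>k. of_nat (k choose j) * (- y) ^ j)"
    using binomial_ring[of "- y" 1 k] by simp
  also have "\<dots> = (\<Sum>j\<le>k. pochhammer (- of_nat k) j / fact j * y ^ j)"
  proof (intro sum.cong refl)
    fix j
    have "(- 1) ^ j * (- y) ^ j = y ^ j" by (simp flip: power_mult_distrib)
    thus "of_nat (k choose j) * (- y) ^ j = pochhammer (- of_nat k) j / fact j * y ^ j"
      by (simp add: binomial_gbinomial gbinomial_pochhammer)
  qed
  finally show ?thesis .
qed

text \<open>Keeps the Euler integrand off the branch cut of the principal power: otherwise
  \<open>z * t\<close> would be real and at least 1, and \<open>t \<le> 1\<close> would put
  \<open>z\<close> on the cut.\<close>

lemma slit_plane_one_minus:
  assumes "z \<in> slit_plane" "t \<in> {0..1}"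
  shows "1 - z * of_real t \<notin> \<real>\<^sub>\<le>\<^sub>0"
proof
  assume "1 - z * of_real t \<in> \<real>\<^sub>\<le>\<^sub>0"
  hence *: "Im z * t = 0" "Re z * t \<ge> 1" by (auto simp: complex_nonpos_Reals_iff)
  hence t: "t > 0" using assms(2) by (cases "t = 0") auto
  have "Re z \<ge> 1"
  proof (rule ccontr)
    assume "\<not> Re z \<ge> 1"
    hence "Re z * t < 1 * t" using t by (intro mult_strict_right_mono) auto
    thus False using * assms(2) by auto
  qed
  thus False using assms(1) * t unfolding slit_plane_iff by simp
qed

subsection \<open>The Euler integral\<close>

text \<open>Since \<open>0 powr s = 0\<close>, the kernel is 0 at both endpoints, even when it is
  unbounded near them.\<close>

definition euler_kernel :: "complex \<Rightarrow> complex \<Rightarrow> real \<Rightarrow> complex" where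
  "euler_kernel a b t = of_real t powr (a - 1) * of_real (1 - t) powr (b - 1)"

definition euler_integral :: "complex \<Rightarrow> complex \<Rightarrow> (real \<Rightarrow> complex) \<Rightarrow> complex" where
  "euler_integral a b f = integral {0..1} (\<lambda>t. f t * euler_kernel a b t)"

context
  fixes a b :: complex
  assumes a: "Re a > 0" and b: "Re b > 0"
begin

lemma norm_euler_kernel:
  assumes "t \<in> {0..1}"
  shows "norm (euler_kernel a b t) = t powr (Re a - 1) * (1 - t) powr (Re b - 1)"
  using assms unfolding euler_kernel_def norm_mult
  by (subst (1 2) norm_powr_real_powr) (auto simp del: of_real_diff)

lemma norm_euler_kernel_has_integral:
  "((\<lambda>t. norm (euler_kernel a b t)) has_integral Beta (Re a) (Re b)) {0..1}"
  by (rule has_integral_eq[OF _ has_integral_Beta_real[OF a b]]) (simp add: norm_euler_kernel)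

text \<open>Continuity on the open interval gives measurability despite possible singularities at
  the endpoints; the norm is a real Beta integrand.\<close>

lemma euler_kernel_absolutely_integrable: "euler_kernel a b absolutely_integrable_on {0..1}"
proof -
  have "euler_kernel a b absolutely_integrable_on {0<..<1}"
  proof (rule measurable_bounded_by_integrable_imp_absolutely_integrable)
    have "continuous_on {0<..<1} (euler_kernel a b)"
      unfolding euler_kernel_def by (intro continuous_intros) auto
    thus "euler_kernel a b \<in> borel_measurable (lebesgue_on {0<..<1})"
      by (rule continuous_imp_measurable_on_sets_lebesgue) auto
    show "(\<lambda>t. norm (euler_kernel a b t)) integrable_on {0<..<1}"
      using norm_euler_kernel_has_integral
      by (auto simp: integrable_on_def simp flip: has_integral_Icc_iff_Ioo)
  qed auto
  thus ?thesis by (simp add: absolutely_integrable_on_Icc_iff_Ioo)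
qed

lemma euler_integrand_integrable:
  assumes "continuous_on {0..1} f"
  shows "(\<lambda>t. f t * euler_kernel a b t) integrable_on {0..1}"
proof -
  have "(\<lambda>t. f t * euler_kernel a b t) absolutely_integrable_on {0..1}"
  proof (rule absolutely_integrable_bounded_measurable_product[OF bilinear_times])
    show "f \<in> borel_measurable (lebesgue_on {0..1})"
      using assms by (rule continuous_imp_measurable_on_sets_lebesgue) auto
    show "bounded (f ` {0..1})"
      by (intro compact_imp_bounded compact_continuous_image assms) auto
  qed (auto intro: euler_kernel_absolutely_integrable)
  thus ?thesis by (rule set_lebesgue_integral_eq_integral)
qed

lemma euler_integral_sum:
  assumes "finite I" "\<And>i. i \<in> I \<Longrightarrow> continuous_on {0..1} (f i)"
  shows "euler_integral a b (\<lambda>t. \<Sum>i\<in>I. c i * f i t) = (\<Sum>i\<in>I. c i * euler_integral a b (f i))"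
proof -
  have "integral {0..1} (\<lambda>t. \<Sum>i\<in>I. c i * (f i t * euler_kernel a b t)) =
        (\<Sum>i\<in>I. integral {0..1} (\<lambda>t. c i * (f i t * euler_kernel a b t)))"
    by (intro integral_sum assms(1) integrable_on_mult_right euler_integrand_integrable assms(2))
  thus ?thesis by (simp add: euler_integral_def sum_distrib_right mult.assoc)
qed

lemma euler_integral_cmult: "euler_integral a b (\<lambda>t. c * f t) = c * euler_integral a b f"
  by (simp add: euler_integral_def mult.assoc)

lemma norm_euler_integral_le:
  assumes "continuous_on {0..1} f" "\<And>t. t \<in> {0..1} \<Longrightarrow> norm (f t) \<le> C"
  shows "norm (euler_integral a b f) \<le> C * Beta (Re a) (Re b)"
proof -
  have "norm (euler_integral a b f) \<le> integral {0..1} (\<lambda>t. C * norm (euler_kernel a b t))"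
    unfolding euler_integral_def
    using norm_euler_kernel_has_integral euler_integrand_integrable[OF assms(1)]
    by (intro integral_norm_bound_integral)
       (auto intro!: integrable_on_mult_right mult_right_mono assms(2) simp: norm_mult)
  also have "\<dots> = C * Beta (Re a) (Re b)"
    using has_integral_mult_right[OF norm_euler_kernel_has_integral] by (rule integral_unique)
  finally show ?thesis .
qed

section \<open>Moments of the kernel and the total mass\<close>

text \<open>Integration of the derivative of \<open>t powr (a + n) * (1 - t) powr b\<close>, a
  function that vanishes at both endpoints.\<close>

lemma euler_integral_moment_Suc:
  "(a + b + of_nat n) * euler_integral a b (\<lambda>t. of_real t ^ Suc n) =
     (a + of_nat n) * euler_integral a b (\<lambda>t. of_real t ^ n)"
proof -
  define G where "G t = of_real t powr (a + of_nat n) * of_real (1 - t) powr b" for t :: real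
  define G' where "G' t = (a + of_nat n) * (of_real t ^ n * euler_kernel a b t) -
      (a + b + of_nat n) * (of_real t ^ Suc n * euler_kernel a b t)" for t :: real
  have "(G' has_integral (G 1 - G 0)) {0..1}"
  \<comment> \<open>\<open>G\<close> may fail to be differentiable at the endpoints; it is
    continuous there because the exponents have positive real part.\<close>
  proof (rule fundamental_theorem_of_calculus_interior)
    show "continuous_on {0..1} G"
      unfolding G_def using a b by (intro continuous_intros) (auto simp: add_pos_nonneg)
    show "(G has_vector_derivative G' t) (at t)" if "t \<in> {0<..<1}" for t
    proof -
      have nz: "complex_of_real t \<noteq> 0" "1 - complex_of_real t \<noteq> 0"
        using that by (auto simp: complex_eq_iff)
      have shift: "a + of_nat n = (a - 1) + of_nat (Suc n)" "a + of_nat n - 1 = (a - 1) + of_nat n"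
        "b = (b - 1) + 1"
        by simp_all
      have pw1: "complex_of_real t powr (a + of_nat n) = of_real t powr (a - 1) * of_real t ^ Suc n"
        unfolding shift(1) powr_add by (simp only: powr_complexpow[OF nz(1)])
      have pw2: "complex_of_real t powr (a + of_nat n - 1) = of_real t powr (a - 1) * of_real t ^ n"
        unfolding shift(2) powr_add by (simp only: powr_complexpow[OF nz(1)])
      have pw3: "(1 - complex_of_real t) powr b = (1 - of_real t) powr (b - 1) * (1 - of_real t)"
        by (subst shift(3), subst powr_add) simp
      note pw = pw1 pw2 pw3
      have "(G has_vector_derivative
             (a + of_nat n) * of_real t powr (a + of_nat n - 1) * of_real (1 - t) powr b
             - of_real t powr (a + of_nat n) * (b * of_real (1 - t) powr (b - 1))) (at t)"
        unfolding G_def using that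
        by (auto intro!: derivative_eq_intros has_vector_derivative_real_field simp: complex_nonpos_Reals_iff)
      also have "(a + of_nat n) * of_real t powr (a + of_nat n - 1) * of_real (1 - t) powr b
             - of_real t powr (a + of_nat n) * (b * of_real (1 - t) powr (b - 1)) = G' t"
        unfolding G'_def euler_kernel_def of_real_diff of_real_1 pw by (simp add: algebra_simps)
      finally show ?thesis .
    qed
  qed auto
  moreover have "G 1 - G 0 = 0" using b by (auto simp: G_def)
  moreover have "(G' has_integral
      (a + of_nat n) * euler_integral a b (\<lambda>t. of_real t ^ n) -
      (a + b + of_nat n) * euler_integral a b (\<lambda>t. of_real t ^ Suc n)) {0..1}"
    unfolding G'_def euler_integral_def
    by (intro has_integral_diff has_integral_mult_right integrable_integral
          euler_integrand_integrable continuous_intros)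
  ultimately have "(a + of_nat n) * euler_integral a b (\<lambda>t. of_real t ^ n) -
      (a + b + of_nat n) * euler_integral a b (\<lambda>t. of_real t ^ Suc n) = 0"
    using has_integral_unique by metis
  thus ?thesis by simp
qed

lemma pochhammer_add_nonzero: "pochhammer (a + b) n \<noteq> 0"
  using a b unfolding pochhammer_eq_0_iff by (auto simp: complex_eq_iff)

text \<open>Iterating the recursion yields the ratio of Pochhammer symbols in the hypergeometric
  coefficients, so integrating a power series in \<open>t\<close> produces a hypergeometric
  series.\<close>

lemma euler_integral_moment:
  "euler_integral a b (\<lambda>t. of_real t ^ n) =
     pochhammer a n / pochhammer (a + b) n * euler_integral a b (\<lambda>_. 1)"
proof (induction n)
  case (Suc n)
  have "a + b + of_nat n \<noteq> 0" using pochhammer_add_nonzero[of "Suc n"] by (auto simp: pochhammer_Suc)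
  thus ?case using euler_integral_moment_Suc[of n] Suc pochhammer_add_nonzero[of n]
    by (simp add: pochhammer_Suc divide_simps del: power_Suc) (simp add: mult_ac del: power_Suc)
qed simp

text \<open>If the total mass were zero, all moments and hence, by the Weierstrass theorem, all integrals
  of continuous functions against the kernel would vanish, in particular that of the conjugate of
  \<open>t powr a * (1 - t) powr b\<close>.\<close>

lemma euler_integral_1_nonzero: "euler_integral a b (\<lambda>_. 1) \<noteq> 0"
proof
  assume zero: "euler_integral a b (\<lambda>_. 1) = 0"
  have real_poly: "euler_integral a b (\<lambda>t. of_real (p t)) = 0" if p: "real_polynomial_function p" for p
  proof -
    from p obtain c n where "p = (\<lambda>t. \<Sum>i\<le>n. c i * t ^ i)"
      using real_polynomial_function_iff_sum by blast
    hence "euler_integral a b (\<lambda>t. of_real (p t)) =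
             euler_integral a b (\<lambda>t. \<Sum>i\<le>n. of_real (c i) * of_real t ^ i)" by simp
    also have "\<dots> = (\<Sum>i\<le>n. of_real (c i) * euler_integral a b (\<lambda>t. of_real t ^ i))"
      by (intro euler_integral_sum) (auto intro!: continuous_intros)
    finally show ?thesis by (simp add: euler_integral_moment zero)
  qed
  define f where "f t = cnj (of_real t powr a * of_real (1 - t) powr b)" for t :: real
  have contf: "continuous_on {0..1} f"
    unfolding f_def using a b by (intro continuous_intros) auto
  \<comment> \<open>For \<open>x > 0\<close> the conjugate of \<open>x powr s\<close> times
    \<open>x powr (s - 1)\<close> is \<open>x powr (2 * Re s - 1)\<close>, so the integrand is a
    real Beta integrand with doubled parameters.\<close>
  have "euler_integral a b f = of_real (Beta (2 * Re a) (2 * Re b))"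
    unfolding euler_integral_def
  proof (rule integral_unique, rule has_integral_eq)
    show "((\<lambda>t. complex_of_real (t powr (2 * Re a - 1) * (1 - t) powr (2 * Re b - 1)))
            has_integral of_real (Beta (2 * Re a) (2 * Re b))) {0..1}"
      using a b by (intro has_integral_of_real has_integral_Beta_real) auto
    fix t :: real assume t: "t \<in> {0..1}"
    have *: "cnj (of_real x powr s) * of_real x powr (s - 1) = of_real (x powr (2 * Re s - 1))"
      if "x \<ge> 0" for x s
    proof (cases "x = 0")
      case False
      with that have x: "x > 0" by simp
      have "cnj (of_real x powr s) * of_real x powr (s - 1) = of_real x powr (cnj s + (s - 1))"
        using x by (simp add: powr_def exp_cnj flip: exp_add) (simp add: algebra_simps Ln_of_real)
      also have "cnj s + (s - 1) = of_real (2 * Re s - 1)" by (simp add: complex_eq_iff)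
      finally show ?thesis using x by (simp only: powr_of_real less_imp_le)
    qed simp
    show "complex_of_real (t powr (2 * Re a - 1) * (1 - t) powr (2 * Re b - 1)) =
            f t * euler_kernel a b t"
      using t unfolding f_def euler_kernel_def of_real_mult
      by (subst (1 2) *[symmetric]) (simp_all add: mult_ac)
  qed
  moreover have "euler_integral a b f = 0"
  proof (rule ccontr)
    assume ne: "euler_integral a b f \<noteq> 0"
    have B: "Beta (Re a) (Re b) > 0" using a b by (simp add: Beta_def Gamma_real_pos)
    \<comment> \<open>This tolerance makes the approximation error at most half the norm of the
      integral, a contradiction once the polynomial part integrates to 0.\<close>
    define e where "e = norm (euler_integral a b f) / (2 * Beta (Re a) (Re b))"
    have "e > 0" using ne B by (simp add: e_def)
    then obtain g where g: "polynomial_function g" "\<And>t. t \<in> {0..1} \<Longrightarrow> norm (f t - g t) < e"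
      using Stone_Weierstrass_polynomial_function[OF _ contf] by (metis compact_Icc)
    have contg: "continuous_on {0..1} g"
      by (intro continuous_on_polymonial_function g)
    have poly: "real_polynomial_function (\<lambda>t. Re (g t))" "real_polynomial_function (\<lambda>t. Im (g t))"
      using g(1) bounded_linear_Re bounded_linear_Im by (auto simp: polynomial_function_def o_def)
    \<comment> \<open>\<open>real_poly\<close> covers real polynomials, so \<open>g\<close> is split
      into real and imaginary part as a two-term sum.\<close>
    define h where "h i t = (if i = (0::nat) then complex_of_real (Re (g t)) else of_real (Im (g t)))" for i t
    have "euler_integral a b g =
            euler_integral a b (\<lambda>t. \<Sum>i\<le>1. (if i = 0 then 1 else \<i>) * h i t)"
      by (intro arg_cong[of _ _ "euler_integral a b"]) (auto simp: complex_eq_iff h_def)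
    also have "\<dots> = (\<Sum>i\<le>1. (if i = 0 then 1 else \<i>) * euler_integral a b (h i))"
    proof (rule euler_integral_sum)
      fix i show "continuous_on {0..1} (h i)"
        by (cases "i = 0") (auto simp: h_def[abs_def] intro!: continuous_intros contg)
    qed auto
    also have "\<dots> = 0" using poly[THEN real_poly] by (simp add: h_def[abs_def])
    finally have "euler_integral a b f = euler_integral a b (\<lambda>t. f t - g t)"
      using integral_diff[OF euler_integrand_integrable[OF contf] euler_integrand_integrable[OF contg]]
      by (simp add: euler_integral_def left_diff_distrib)
    also have "norm \<dots> \<le> e * Beta (Re a) (Re b)"
      using g(2) by (intro norm_euler_integral_le continuous_intros contf contg) (auto intro: less_imp_le)
    also have "\<dots> < norm (euler_integral a b f)" using B ne by (simp add: e_def)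
    finally show False by simp
  qed
  moreover have "Beta (2 * Re a) (2 * Re b) > 0" using a b by (simp add: Beta_def Gamma_real_pos)
  ultimately show False by simp
qed

section \<open>Termwise integration of binomial series\<close>

text \<open>The uniform bound \<open>q < 1\<close> dominates all partial sums by a constant multiple
  of the norm of the kernel, so dominated convergence applies. The weight \<open>v\<close> serves
  the expansion around an arbitrary centre.\<close>

lemma euler_integral_binomial_sums:
  assumes v: "continuous_on {0..1} v" and u: "continuous_on {0..1} u"
    and le: "\<And>t. t \<in> {0..1} \<Longrightarrow> norm (u t) \<le> q" and q: "q < 1"
  shows "(\<lambda>n. pochhammer g n / fact n * euler_integral a b (\<lambda>t. v t * u t ^ n)) sums
           euler_integral a b (\<lambda>t. v t * (1 - u t) powr (- g))"
proof -
  have q0: "q \<ge> 0" using le[of 0] norm_ge_zero[of "u 0"] by (meson atLeastAtMost_iff order.trans order_refl zero_le_one)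
  define c where "c n = pochhammer g n / fact n" for n
  define C where "C = (\<Sum>n. norm (c n) * q ^ n)"
  have summ: "summable (\<lambda>n. norm (c n) * q ^ n)"
  proof -
    \<comment> \<open>The point \<open>(1 + q) / 2\<close> lies strictly between \<open>q\<close>
      and 1; convergence there gives absolute convergence at \<open>q\<close>.\<close>
    have "summable (\<lambda>n. c n * (of_real ((1 + q) / 2)) ^ n)"
      unfolding c_def by (rule sums_summable[OF pochhammer_binomial_sums])
        (use q q0 in \<open>simp del: of_real_divide of_real_add\<close>)
    from powser_insidea[OF this, of "of_real q"] show ?thesis
      using q q0 by (simp add: norm_mult norm_power del: of_real_divide of_real_add)
  qed
  obtain V where V: "\<And>t. t \<in> {0..1} \<Longrightarrow> norm (v t) \<le> V"
    using compact_imp_bounded[OF compact_continuous_image[OF v compact_Icc]]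
    unfolding bounded_iff by blast
  let ?f = "\<lambda>N t. (\<Sum>n<N. c n * (v t * u t ^ n)) * euler_kernel a b t"
  have "(\<lambda>N. integral {0..1} (?f N)) \<longlonglongrightarrow>
          integral {0..1} (\<lambda>t. (v t * (1 - u t) powr (- g)) * euler_kernel a b t)"
  proof (rule dominated_convergence)
    show "?f N integrable_on {0..1}" for N
      by (intro euler_integrand_integrable continuous_intros u v)
    show "(\<lambda>t. V * C * norm (euler_kernel a b t)) integrable_on {0..1}"
      using norm_euler_kernel_has_integral by (intro integrable_on_mult_right) auto
    fix t :: real assume t: "t \<in> {0..1}"
    have V0: "V \<ge> 0" using norm_ge_zero V[OF t] by (rule order_trans)
    show "norm (?f N t) \<le> V * C * norm (euler_kernel a b t)" for N
    proof -
      have "norm (\<Sum>n<N. c n * (v t * u t ^ n)) \<le> (\<Sum>n<N. V * (norm (c n) * q ^ n))"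
        using V[OF t] le[OF t] q0 V0
        by (intro sum_norm_le, subst mult.left_commute, unfold norm_mult norm_power)
           (intro mult_left_mono mult_mono power_mono, auto)
      also have "\<dots> \<le> V * C"
        unfolding sum_distrib_left[symmetric] C_def using V0 q0
        by (intro mult_left_mono sum_le_suminf summ) auto
      finally show ?thesis by (auto simp: norm_mult intro: mult_right_mono)
    qed
    have "(\<lambda>n. v t * (c n * u t ^ n)) sums (v t * (1 - u t) powr (- g))"
      unfolding c_def using le[OF t] q by (intro sums_mult pochhammer_binomial_sums) auto
    thus "(\<lambda>N. ?f N t) \<longlonglongrightarrow> (v t * (1 - u t) powr (- g)) * euler_kernel a b t"
      unfolding sums_def by (intro tendsto_mult_right) (simp add: algebra_simps)
  qed
  moreover have "integral {0..1} (?f N) = (\<Sum>n<N. c n * euler_integral a b (\<lambda>t. v t * u t ^ n))" for N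
    by (subst euler_integral_sum[symmetric])
       (auto simp: euler_integral_def intro!: continuous_intros u v)
  ultimately show ?thesis unfolding sums_def c_def euler_integral_def by simp
qed


subsection \<open>Euler's representation of the hypergeometric function\<close>

text \<open>Around \<open>z\<close>, the factorization
  \<open>1 - w * t = (1 - z * t) * (1 - u w t)\<close> with \<open>u\<close> linear in
  \<open>w - z\<close> turns the binomial series into a power series in \<open>w - z\<close> that
  can be integrated termwise.\<close>

lemma euler_integral_holomorphic:
  "(\<lambda>z. euler_integral a b (\<lambda>t. (1 - z * of_real t) powr (- g))) holomorphic_on slit_plane"
proof -
  let ?E = "\<lambda>z. euler_integral a b (\<lambda>t. (1 - z * of_real t) powr (- g))"
  have "\<exists>r>0. ?E holomorphic_on ball z r" if z: "z \<in> slit_plane" for z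
  proof -
    obtain r0 where r0: "r0 > 0" "ball z r0 \<subseteq> slit_plane"
      using open_slit_plane z open_contains_ball by blast
    have nz: "1 - z * of_real t \<noteq> 0" if "t \<in> {0..1}" for t
      using slit_plane_one_minus[OF z that] by auto
    obtain t0 where t0: "t0 \<in> {0..1}"
        "\<And>t. t \<in> {0..1} \<Longrightarrow> norm (1 - z * of_real t0) \<le> norm (1 - z * of_real t)"
      using continuous_attains_inf[of "{0..1::real}" "\<lambda>t. norm (1 - z * of_real t)"]
      by (fastforce intro!: continuous_intros)
    define d where "d = norm (1 - z * of_real t0)"
    have d: "d > 0" using nz[OF t0(1)] by (simp add: d_def)
    \<comment> \<open>The bound \<open>r0\<close> keeps the ball in the slit plane;
      \<open>d / 2\<close>, half the minimum of \<open>norm (1 - z * t)\<close>, makes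
      \<open>norm (u w t) \<le> 1 / 2\<close>.\<close>
    define r where "r = min r0 (d / 2)"
    have r: "r > 0" "ball z r \<subseteq> slit_plane" using r0 d by (auto simp: r_def)
    define u where "u w t = (w - z) * (of_real t / (1 - z * of_real t))" for w t
    have norm_u: "norm (u w t) \<le> 1 / 2" if "w \<in> ball z r" "t \<in> {0..1}" for w t
    proof -
      have "norm (w - z) * \<bar>t\<bar> \<le> d / 2 * 1"
        using that d by (intro mult_mono) (auto simp: dist_norm norm_minus_commute r_def)
      also have "\<dots> \<le> norm (1 - z * of_real t) / 2" using t0(2)[OF that(2)] by (simp add: d_def)
      finally show ?thesis using nz[OF that(2)]
        by (simp add: u_def norm_mult norm_divide divide_simps)
    qed
    have u_notin: "1 - u w t \<notin> \<real>\<^sub>\<le>\<^sub>0" if "w \<in> ball z r" "t \<in> {0..1}" for w t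
      using norm_u[OF that] complex_Re_le_cmod[of "u w t"] by (auto simp: complex_nonpos_Reals_iff)
    \<comment> \<open>Both sides are logarithms of the same function and agree at the centre of the ball.\<close>
    have Ln_deriv: "((\<lambda>w. Ln (1 - w * c) - Ln (1 - (w - z) * d)) has_field_derivative
                       - c / (1 - w * c) + d / (1 - (w - z) * d)) (at w)"
      if "1 - w * c \<notin> \<real>\<^sub>\<le>\<^sub>0" "1 - (w - z) * d \<notin> \<real>\<^sub>\<le>\<^sub>0" for c d w
      using that by (auto intro!: derivative_eq_intros simp: divide_inverse)
    have Ln_eq: "Ln (1 - w * of_real t) = Ln (1 - z * of_real t) + Ln (1 - u w t)"
      if w: "w \<in> ball z r" and t: "t \<in> {0..1}" for w t
    proof -
      define D where "D w = Ln (1 - w * of_real t) - Ln (1 - u w t)" for w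
      have "\<exists>c. \<forall>w\<in>ball z r. D w = c"
      proof (rule has_field_derivative_zero_constant)
        fix w assume w: "w \<in> ball z r"
        have nz': "1 - w * of_real t \<noteq> 0" "1 - u w t \<noteq> 0"
          using slit_plane_one_minus[of w t] u_notin[of w t] w t r by auto
        have "(D has_field_derivative
                - of_real t / (1 - w * of_real t) + (of_real t / (1 - z * of_real t)) / (1 - u w t)) (at w)"
          unfolding D_def u_def
          using slit_plane_one_minus[of w t] u_notin[OF w t] w t r
          by (intro Ln_deriv) (auto simp: u_def)
        also have "(1 - u w t) * (1 - z * of_real t) = 1 - w * of_real t"
          using nz[OF t] by (simp add: u_def field_simps)
        hence "(of_real t / (1 - z * of_real t)) / (1 - u w t) = of_real t / (1 - w * of_real t)"
          by (simp add: mult.commute)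
        hence "- of_real t / (1 - w * of_real t) + (of_real t / (1 - z * of_real t)) / (1 - u w t) = 0"
          by simp
        finally show "(D has_field_derivative 0) (at w within ball z r)"
          by (rule has_field_derivative_at_within)
      qed auto
      hence "D w = D z" using w r(1) by (metis centre_in_ball)
      thus ?thesis by (simp add: D_def u_def algebra_simps)
    qed
    have "((\<lambda>n. (pochhammer g n / fact n * euler_integral a b (\<lambda>t. (1 - z * of_real t) powr (- g) *
              (of_real t / (1 - z * of_real t)) ^ n)) * (w - z) ^ n) sums ?E w)"
      if w: "w \<in> ball z r" for w
    proof -
      have "(\<lambda>n. pochhammer g n / fact n * euler_integral a b (\<lambda>t. (1 - z * of_real t) powr (- g) * u w t ^ n))
              sums euler_integral a b (\<lambda>t. (1 - z * of_real t) powr (- g) * (1 - u w t) powr (- g))"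
      proof (rule euler_integral_binomial_sums)
        show "continuous_on {0..1} (\<lambda>t. (1 - z * of_real t) powr (- g))"
        proof (intro continuous_intros)
          show "{0..1} \<subseteq> {t. Re (1 - z * of_real t) \<ge> 0 \<or> Im (1 - z * of_real t) \<noteq> 0}"
            using slit_plane_one_minus[OF z] unfolding complex_nonpos_Reals_iff by force
        qed (use nz in auto)
        show "continuous_on {0..1} (u w)"
          unfolding u_def using nz by (intro continuous_intros) auto
        show "norm (u w t) \<le> 1 / 2" if "t \<in> {0..1}" for t by (rule norm_u[OF w that])
      qed auto
      moreover have "euler_integral a b (\<lambda>t. (1 - z * of_real t) powr (- g) * (1 - u w t) powr (- g)) = ?E w"
        unfolding euler_integral_def
      proof (rule integral_cong)
        fix t :: real assume t: "t \<in> {0..1}"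
        have "1 - w * of_real t \<noteq> 0" "1 - u w t \<noteq> 0"
          using slit_plane_one_minus[of w t] u_notin[of w t] w t r by auto
        hence "(1 - z * of_real t) powr (- g) * (1 - u w t) powr (- g) = (1 - w * of_real t) powr (- g)"
          using nz[OF t] by (simp add: powr_def Ln_eq[OF w t] ring_distribs flip: exp_add)
        thus "(1 - z * of_real t) powr (- g) * (1 - u w t) powr (- g) * euler_kernel a b t =
                (1 - w * of_real t) powr (- g) * euler_kernel a b t" by simp
      qed
      moreover have "euler_integral a b (\<lambda>t. (1 - z * of_real t) powr (- g) * u w t ^ n) =
          (w - z) ^ n * euler_integral a b (\<lambda>t. (1 - z * of_real t) powr (- g) *
              (of_real t / (1 - z * of_real t)) ^ n)" for n
        unfolding u_def power_mult_distrib mult.left_commute[of _ "(w - z) ^ n"]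
        by (rule euler_integral_cmult)
      ultimately show ?thesis by (simp add: mult_ac)
    qed
    from power_series_holomorphic[OF this] r(1) show ?thesis by blast
  qed
  thus ?thesis
    using open_slit_plane by (subst analytic_on_open[symmetric]) (auto simp: analytic_on_def)
qed

text \<open>The quotient is holomorphic on the slit plane, and the moments identify it with the
  series in the unit disc; uniqueness of the continuation does the rest.\<close>

lemma hyp2F1_euler:
  assumes "z \<in> slit_plane"
  shows "hyp2F1 g a (a + b) z =
           euler_integral a b (\<lambda>t. (1 - z * of_real t) powr (- g)) / euler_integral a b (\<lambda>_. 1)"
proof (rule hyp2F1_eqI[OF _ _ assms])
  show "(\<lambda>z. euler_integral a b (\<lambda>t. (1 - z * of_real t) powr (- g)) / euler_integral a b (\<lambda>_. 1))
          holomorphic_on slit_plane"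
    by (intro holomorphic_on_divide euler_integral_holomorphic)
       (auto simp: euler_integral_1_nonzero)
  fix z :: complex assume z: "norm z < 1"
  have "(\<lambda>n. pochhammer g n / fact n * euler_integral a b (\<lambda>t. 1 * (z * of_real t) ^ n))
          sums euler_integral a b (\<lambda>t. 1 * (1 - z * of_real t) powr (- g))"
    by (rule euler_integral_binomial_sums[where q = "norm z"])
       (use z in \<open>auto intro!: continuous_intros mult_left_le simp: norm_mult\<close>)
  hence "(\<lambda>n. pochhammer g n / fact n * (z ^ n * euler_integral a b (\<lambda>t. of_real t ^ n)))
          sums euler_integral a b (\<lambda>t. (1 - z * of_real t) powr (- g))"
    by (simp add: power_mult_distrib euler_integral_cmult)
  from sums_divide[OF this, of "euler_integral a b (\<lambda>_. 1)"]
  have "(\<lambda>n. pochhammer g n * pochhammer a n / pochhammer (a + b) n * (z ^ n / fact n))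
          sums (euler_integral a b (\<lambda>t. (1 - z * of_real t) powr (- g)) / euler_integral a b (\<lambda>_. 1))"
    using euler_integral_1_nonzero by (simp add: euler_integral_moment field_simps)
  thus "euler_integral a b (\<lambda>t. (1 - z * of_real t) powr (- g)) / euler_integral a b (\<lambda>_. 1) =
          hyp2F1_series g a (a + b) z"
    by (simp add: hyp2F1_series_altdef sums_iff)
qed

text \<open>The series terminates, so linearity and the moments give the formula at every
  \<open>z\<close>, including points of the cut such as \<open>z = 2\<close>, which occurs for
  \<open>\<psi> = pi / 2\<close>.\<close>

lemma hyp2F1_euler_polynomial:
  "hyp2F1 (- of_nat k) a (a + b) z =
     euler_integral a b (\<lambda>t. (1 - z * of_real t) ^ k) / euler_integral a b (\<lambda>_. 1)"
proof -
  have "hyp2F1 (- of_nat k) a (a + b) z =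
          (\<Sum>j. pochhammer (- of_nat k) j * pochhammer a j / pochhammer (a + b) j * (z ^ j / fact j))"
    by (simp add: hyp2F1_def hyp2F1_series_altdef)
  also have "\<dots> = (\<Sum>j\<le>k. pochhammer (- of_nat k) j * pochhammer a j / pochhammer (a + b) j * (z ^ j / fact j))"
    by (rule suminf_finite) (auto simp: pochhammer_of_nat_eq_0_lemma)
  also have "\<dots> = (\<Sum>j\<le>k. (pochhammer (- of_nat k) j / fact j * z ^ j) * euler_integral a b (\<lambda>t. of_real t ^ j))
                    / euler_integral a b (\<lambda>_. 1)"
    unfolding sum_divide_distrib
    by (intro sum.cong refl) (simp add: euler_integral_moment euler_integral_1_nonzero mult_ac)
  also have "(\<Sum>j\<le>k. (pochhammer (- of_nat k) j / fact j * z ^ j) * euler_integral a b (\<lambda>t. of_real t ^ j))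
      = euler_integral a b (\<lambda>t. \<Sum>j\<le>k. (pochhammer (- of_nat k) j / fact j * z ^ j) * of_real t ^ j)"
    by (intro euler_integral_sum[symmetric]) (auto intro!: continuous_intros)
  also have "\<dots> = euler_integral a b (\<lambda>t. (1 - z * of_real t) ^ k)"
    by (simp add: one_minus_power_eq_sum power_mult_distrib mult_ac)
  finally show ?thesis .
qed

section \<open>Generating function of the terminating series\<close>

text \<open>Under the integral the sum is \<open>(1 - w * (1 - z * t)) powr (- g)\<close>, whose
  base factors as \<open>(1 - w) * (1 - Z * t)\<close>; the second factor is again an Euler
  integrand.\<close>

lemma hyp2F1_generating_function:
  assumes z: "norm (1 - z) \<le> 1" and w: "norm w < 1"
  shows "(\<lambda>k. pochhammer g k / fact k * w ^ k * hyp2F1 (- of_nat k) a (a + b) z) sums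
           ((1 - w) powr (- g) * hyp2F1 g a (a + b) (z * w / (w - 1)))"
proof -
  let ?K = "euler_integral a b (\<lambda>_. 1)"
  define Z where "Z = z * w / (w - 1)"
  have w1: "w \<noteq> 1" and Re_w: "Re (1 - w) > 0"
    using w complex_Re_le_cmod[of w] by auto
  have le: "norm (w * (1 - z * of_real t)) \<le> norm w" if "t \<in> {0..1}" for t
  proof -
    \<comment> \<open>A convex combination of 1 and \<open>1 - z\<close>, both in the closed unit
      disc.\<close>
    have "1 - z * of_real t = of_real (1 - t) + of_real t * (1 - z)" by (simp add: algebra_simps)
    hence "norm (1 - z * of_real t) \<le> norm (complex_of_real (1 - t)) + norm (of_real t * (1 - z))"
      by (metis norm_triangle_ineq)
    also have "\<dots> \<le> (1 - t) + t * 1"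
      using that z by (intro add_mono) (auto simp: norm_mult simp del: of_real_diff intro!: mult_left_le)
    finally show ?thesis by (simp add: norm_mult mult_left_le)
  qed
  have factor: "1 - w * (1 - z * of_real t) = (1 - w) * (1 - Z * of_real t)" for t
    using w1 by (simp add: Z_def divide_simps) (simp add: algebra_simps)
  have Re_pos: "Re ((1 - w) * (1 - Z * of_real t)) > 0" if "t \<in> {0..1}" for t
    using le[OF that] w complex_Re_le_cmod[of "w * (1 - z * of_real t)"]
    unfolding factor[symmetric] by auto
  \<comment> \<open>A real \<open>Z = s \<ge> 1\<close> would make the product in
    \<open>Re_pos\<close> vanish at \<open>t = 1 / s\<close>, which lies in the unit
    interval.\<close>
  have Z: "Z \<in> slit_plane"
  proof (rule ccontr)
    assume "Z \<notin> slit_plane"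
    then obtain s where s: "s \<ge> 1" "Z = of_real s" by auto
    hence "1 - Z * of_real (1 / s) = 0" by simp
    thus False using Re_pos[of "1 / s"] s(1) by simp
  qed
  have "(\<lambda>k. pochhammer g k / fact k * euler_integral a b (\<lambda>t. 1 * (w * (1 - z * of_real t)) ^ k)) sums
          euler_integral a b (\<lambda>t. 1 * (1 - w * (1 - z * of_real t)) powr (- g))"
    by (rule euler_integral_binomial_sums[OF _ _ le w]) (auto intro!: continuous_intros)
  also have "euler_integral a b (\<lambda>t. 1 * (1 - w * (1 - z * of_real t)) powr (- g)) =
      euler_integral a b (\<lambda>t. (1 - w) powr (- g) * (1 - Z * of_real t) powr (- g))"
    unfolding euler_integral_def factor
    by (rule integral_cong) (use powr_mult_right_halfplane[OF Re_w Re_pos] in auto)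
  also have "\<dots> = (1 - w) powr (- g) * (?K * hyp2F1 g a (a + b) Z)"
    by (simp add: euler_integral_cmult hyp2F1_euler[OF Z] euler_integral_1_nonzero)
  finally have "(\<lambda>k. pochhammer g k / fact k * (w ^ k * (?K * hyp2F1 (- of_nat k) a (a + b) z))) sums
      ((1 - w) powr (- g) * (?K * hyp2F1 g a (a + b) Z))"
    by (simp add: power_mult_distrib euler_integral_cmult hyp2F1_euler_polynomial euler_integral_1_nonzero)
  from sums_divide[OF this, of ?K] show ?thesis
    by (simp add: euler_integral_1_nonzero Z_def mult_ac)
qed

end

section \<open>Specialization to the trigonometric parameters\<close>

theorem theorem5p5:
  fixes l x \<psi> \<phi> :: real and \<gamma> \<rho> :: complex
  assumes "l > 0"
    and "0 < \<psi>" and "\<psi> < pi" and "0 < \<phi>" and "\<phi> < pi"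
    and "norm \<rho> * (sin \<phi> + \<bar>sin (\<psi> - \<phi>)\<bar>) < sin \<psi>"
  shows
    "let B = 1 - \<rho> * of_real (sin (\<psi> - \<phi>)) / (exp (\<i> * of_real \<phi>) * of_real (sin \<psi>));
         t = (\<lambda>k::nat.
           of_real (sin \<phi>) ^ k / of_real (sin \<psi>) ^ k * B powi (- int k) *
           (pochhammer \<gamma> k * meixner_pollaczek k l x \<psi> /
             (pochhammer (of_real (2 * l)) k * exp (\<i> * of_nat k * of_real \<phi>))) * \<rho> ^ k)
     in summable t \<and>
        (1 - \<rho>) powr (- \<gamma>) *
          hyp2F1 \<gamma> (of_real l + \<i> * of_real x) (of_real (2 * l))
            ((1 - exp (- 2 * \<i> * of_real \<phi>)) * \<rho> / (\<rho> - 1))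
        = B powr (- \<gamma>) * (\<Sum>k. t k)"
proof -
  define B where "B = 1 - \<rho> * of_real (sin (\<psi> - \<phi>)) / (exp (\<i> * of_real \<phi>) * of_real (sin \<psi>))"
  define t where "t = (\<lambda>k::nat.
           of_real (sin \<phi>) ^ k / of_real (sin \<psi>) ^ k * B powi (- int k) *
           (pochhammer \<gamma> k * meixner_pollaczek k l x \<psi> /
             (pochhammer (of_real (2 * l)) k * exp (\<i> * of_nat k * of_real \<phi>))) * \<rho> ^ k)"
  define a where "a = of_real l + \<i> * of_real x"
  define b where "b = of_real l - \<i> * of_real x"
  have a: "Re a > 0" and b: "Re b > 0" and ab: "of_real (2 * l) = a + b"
    using assms(1) by (auto simp: a_def b_def)
  \<comment> \<open>In terms of \<open>p\<close> and \<open>q\<close> all sines and exponentials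
    become rational, so the trigonometric identities reduce to field arithmetic.\<close>
  define p where "p = exp (\<i> * of_real \<psi>)"
  define q where "q = exp (\<i> * of_real \<phi>)"
  have pq [simp]: "p \<noteq> 0" "q \<noteq> 0" by (simp_all add: p_def q_def)
  have exps: "exp (- 2 * \<i> * of_real \<psi>) = 1 / p ^ 2" "exp (- 2 * \<i> * of_real \<phi>) = 1 / q ^ 2"
    by (simp_all add: p_def q_def exp_minus field_simps flip: exp_double)
  have sines: "of_real (sin \<psi>) = (p - 1 / p) / (2 * \<i>)" "of_real (sin \<phi>) = (q - 1 / q) / (2 * \<i>)"
    "of_real (sin (\<psi> - \<phi>)) = (p / q - q / p) / (2 * \<i>)"
    unfolding p_def q_def sin_of_real[symmetric] of_real_diff
    by (simp_all add: sin_exp_eq exp_minus exp_diff field_simps)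
  have sin_pos: "sin \<psi> > 0" "sin \<phi> > 0" using assms by (auto intro: sin_gt_zero)
  \<comment> \<open>Everything raised to the power \<open>k\<close> in \<open>t k\<close> is
    collected here; the factor \<open>p\<close> comes from the exponential in the Meixner-Pollaczek
    polynomial.\<close>
  define w where "w = of_real (sin \<phi>) * \<rho> * p / (q * of_real (sin \<psi>) * B)"
  \<comment> \<open>The hypothesis divided by \<open>sin \<psi>\<close> bounds
    \<open>norm (1 - B)\<close> by \<open>1 - r\<close> with
    \<open>r = norm \<rho> * sin \<phi> / sin \<psi>\<close>. Hence \<open>norm B > r\<close> and
    \<open>Re B > 0\<close>, and \<open>norm w = r / norm B\<close> is below 1.\<close>
  have norm_B: "norm (1 - B) = norm \<rho> * \<bar>sin (\<psi> - \<phi>)\<bar> / sin \<psi>"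
    using sin_pos by (simp add: B_def norm_mult norm_divide)
  also have "\<dots> < 1 - norm \<rho> * sin \<phi> / sin \<psi>"
    using assms(6) sin_pos by (simp add: field_simps)
  finally have B_less: "norm (1 - B) < 1 - norm \<rho> * sin \<phi> / sin \<psi>" .
  have B_norm: "norm B > norm \<rho> * sin \<phi> / sin \<psi>"
    using B_less norm_triangle_ineq2[of 1 "1 - B"] by simp
  have "norm \<rho> * sin \<phi> / sin \<psi> \<ge> 0" using sin_pos by simp
  hence Re_B: "Re B > 0" and B0: "B \<noteq> 0"
    using B_less B_norm complex_Re_le_cmod[of "1 - B"] by auto
  have w: "norm w < 1"
  proof -
    have "norm w = (norm \<rho> * sin \<phi> / sin \<psi>) / norm B"
      using sin_pos by (simp add: w_def norm_mult norm_divide p_def q_def)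
    also have "\<dots> < 1" using B_norm B0 by (subst divide_less_eq_1_pos) auto
    finally show ?thesis .
  qed
  have sin0: "complex_of_real (sin \<psi>) \<noteq> 0" using sin_pos by simp
  \<comment> \<open>This identity is used twice: to factor \<open>1 - \<rho>\<close> as
    \<open>B * (1 - w)\<close>, and through the triangle inequality to obtain
    \<open>norm \<rho> < 1\<close>.\<close>
  have sine_sum: "of_real (sin (\<psi> - \<phi>)) + of_real (sin \<phi>) * p = q * of_real (sin \<psi>)"
    unfolding sines by (simp add: field_simps)
  have Bw: "B * w = of_real (sin \<phi>) * \<rho> * p / (q * of_real (sin \<psi>))"
    using B0 by (simp add: w_def)
  have one_minus_rho: "1 - \<rho> = B * (1 - w)"
  proof -
    have "B * (1 - w) = B - B * w" by (simp add: algebra_simps)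
    also have "\<dots> = 1 - \<rho> * (of_real (sin (\<psi> - \<phi>)) + of_real (sin \<phi>) * p) / (q * of_real (sin \<psi>))"
      unfolding Bw by (simp add: B_def q_def[symmetric] add_divide_distrib algebra_simps)
    finally show ?thesis unfolding sine_sum using sin0 by simp
  qed
  have arg: "(1 - 1 / p ^ 2) * w / (w - 1) = (1 - 1 / q ^ 2) * \<rho> / (\<rho> - 1)"
  proof -
    \<comment> \<open>Expanding the fraction by \<open>- B\<close> turns its denominator into
      \<open>\<rho> - 1\<close> and leaves \<open>B * w\<close>, which is free of \<open>B\<close>,
      in the numerator.\<close>
    have "(1 - 1 / p ^ 2) * w / (w - 1) = (1 - 1 / p ^ 2) * (B * w) / (- (B * (1 - w)))"
      using B0 unfolding mult_minus_right[symmetric] by simp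
    also have "(1 - 1 / p ^ 2) * (B * w) = (1 - 1 / q ^ 2) * \<rho>"
    proof -
      have "(1 - 1 / p ^ 2) * p = 2 * \<i> * of_real (sin \<psi>)" "1 - 1 / q ^ 2 = 2 * \<i> * of_real (sin \<phi>) / q"
        unfolding sines by (simp_all add: field_simps power2_eq_square)
      moreover have "(1 - 1 / p ^ 2) * (B * w) =
                       ((1 - 1 / p ^ 2) * p) * (of_real (sin \<phi>) * \<rho> / (q * of_real (sin \<psi>)))"
        unfolding Bw by simp
      ultimately show ?thesis using sin0 by simp
    qed
    finally show ?thesis unfolding one_minus_rho[symmetric] by simp
  qed
  have Re_rho: "Re (B * (1 - w)) > 0"
  proof -
    have "sin \<psi> = norm (q * of_real (sin \<psi>))" using sin_pos by (simp add: q_def norm_mult)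
    also have "\<dots> \<le> norm (complex_of_real (sin (\<psi> - \<phi>))) + norm (of_real (sin \<phi>) * p)"
      unfolding sine_sum[symmetric] by (rule norm_triangle_ineq)
    also have "\<dots> = sin \<phi> + \<bar>sin (\<psi> - \<phi>)\<bar>" using sin_pos by (simp add: p_def norm_mult)
    finally have "norm \<rho> * (sin \<phi> + \<bar>sin (\<psi> - \<phi>)\<bar>) < 1 * (sin \<phi> + \<bar>sin (\<psi> - \<phi>)\<bar>)"
      using assms(6) by simp
    hence "norm \<rho> < 1" using sin_pos by (subst (asm) mult_less_cancel_right) auto
    thus ?thesis unfolding one_minus_rho[symmetric] using complex_Re_le_cmod[of \<rho>] by simp
  qed
  have t_eq: "t k = pochhammer \<gamma> k / fact k * w ^ k * hyp2F1 (- of_nat k) a (a + b) (1 - 1 / p ^ 2)" for k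
  proof -
    have "exp (\<i> * of_nat k * of_real \<psi>) = p ^ k" "exp (\<i> * of_nat k * of_real \<phi>) = q ^ k"
      by (simp_all add: p_def q_def mult_ac flip: exp_of_nat_mult)
    thus ?thesis using pochhammer_add_nonzero[OF a b, of k] sin0 B0
      unfolding t_def meixner_pollaczek_def ab exps a_def[symmetric]
      by (simp add: w_def power_int_minus power_mult_distrib power_divide divide_simps)
  qed
  have "norm (1 - (1 - 1 / p ^ 2)) \<le> 1" by (simp add: p_def norm_divide norm_power)
  from hyp2F1_generating_function[OF a b this w, of \<gamma>]
  have "t sums ((1 - w) powr (- \<gamma>) * hyp2F1 \<gamma> a (a + b) ((1 - 1 / q ^ 2) * \<rho> / (\<rho> - 1)))"
    unfolding t_eq arg .
  moreover have "(1 - \<rho>) powr (- \<gamma>) = B powr (- \<gamma>) * (1 - w) powr (- \<gamma>)"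
    unfolding one_minus_rho using Re_B Re_rho by (rule powr_mult_right_halfplane)
  ultimately show ?thesis
    unfolding Let_def B_def[symmetric] t_def[symmetric]
    unfolding a_def[symmetric] ab exps
    by (simp add: sums_iff mult.assoc)
qed

end
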